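(* Let $r\ge 1$ and $n\ge 1$ be integers. For nonnegative integers $\alpha_1,\dots,\alpha_r$ with $\sum_{i=1}^r i\alpha_i=n$, let $\mathcal{O}_n(\alpha_1,\dots,\alpha_r)$ be the number of preference orderings of an $n$-element set having exactly $\alpha_i$ blocks of size $i$ for each $i$. Then, as polynomials in $x_1,\dots,x_r$, $$n!\,F^{[r]}_{n+r-1}\Big(x_1,\tfrac{1}{2!}x_2,\tfrac{1}{3!}x_3,\dots,\tfrac{1}{r!}x_r\Big)=\sum_{\substack{\alpha_1,\dots,\alpha_r\ge 0\\ \sum_{i=1}^r i\alpha_i=n}}\mathcal{O}_n(\alpha_1,\dots,\alpha_r)\,x_1^{\alpha_1}x_2^{\alpha_2}\cdots x_r^{\alpha_r}.$$
   Context: For an integer $r\ge 1$, the $r$-Fibonacci polynomial $F^{[r]}_n(x_1,\dots,x_r)$ is defined by $F^{[r]}_n=0$ for $0\le n<r-1$, $F^{[r]}_{r-1}=1$, and $F^{[r]}_n=\sum_{i=1}^r x_iF^{[r]}_{n-i}$ for $n\ge r$. A preference ordering of a finite set is an ordered set partition: a partition of the set into nonempty blocks together with a linear order on the blocks. *)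

theory Defs
  imports
    Complex_Main
    "HOL-Library.Poly_Mapping"
    "HOL-Library.Disjoint_Sets"
    "HOL-Library.FuncSet"
begin

section \<open>Multivariate polynomials\<close>

text \<open>
  Polynomials with rational coefficients in the variables $x_0, x_1, x_2, \ldots$: finitely
  supported functions from monomials (finitely supported exponent vectors) to coefficients.
  The product of \<open>HOL-Library.Poly_Mapping\<close> is the convolution product, i.e. the usual product of
  polynomials. The variable $x_0$ exists in this ring but is never used.
\<close>

type_synonym mpoly = "(nat \<Rightarrow>\<^sub>0 nat) \<Rightarrow>\<^sub>0 rat"

definition Var :: "nat \<Rightarrow> mpoly" where
  "Var i = Poly_Mapping.single (Poly_Mapping.single i 1) 1"

definition Const :: "rat \<Rightarrow> mpoly" where
  "Const c = Poly_Mapping.single 0 c"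

definition mpoly_subst :: "(nat \<Rightarrow> mpoly) \<Rightarrow> mpoly \<Rightarrow> mpoly" where
  "mpoly_subst f p =
     (\<Sum>m \<in> Poly_Mapping.keys p.
        Const (Poly_Mapping.lookup p m) *
        (\<Prod>i \<in> Poly_Mapping.keys m. f i ^ Poly_Mapping.lookup m i))"

section \<open>The r-Fibonacci polynomials\<close>

text \<open>
  The case distinction is $n < r - 1$, $n = r - 1$, $n \ge r$, written with \<open>n + 1\<close> because of
  truncated subtraction.
\<close>

function rfib :: "nat \<Rightarrow> nat \<Rightarrow> mpoly" where
  "rfib r n =
     (if n + 1 < r then 0
      else if n + 1 = r then 1
      else (\<Sum>i = 1..r. Var i * rfib r (n - i)))"
  by pat_completeness auto
termination
  by (relation "measure snd") auto

declare rfib.simps [simp del]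

section \<open>Preference orderings\<close>

text \<open>
  A linear order on the blocks is represented by its (reflexive) relation, as a set of pairs of
  blocks; \<open>linear_order_on P L\<close> includes \<open>L \<subseteq> P \<times> P\<close>, so distinct pairs \<open>(P, L)\<close> are distinct
  preference orderings.
\<close>

definition preference_orderings :: "'a set \<Rightarrow> ('a set set \<times> 'a set rel) set" where
  "preference_orderings A = {(P, L). partition_on A P \<and> linear_order_on P L}"

definition num_pref :: "'a set \<Rightarrow> nat \<Rightarrow> (nat \<Rightarrow> nat) \<Rightarrow> nat" where
  "num_pref A r \<alpha> =
     card {(P, L) \<in> preference_orderings A. \<forall>i\<in>{1..r}. card {B \<in> P. card B = i} = \<alpha> i}"

text \<open>
  The tuples $(\alpha_1, \ldots, \alpha_r)$ are functions on \<open>{1..r}\<close>, extensional outside so that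
  each tuple occurs only once. Given $\sum_i i \alpha_i = |A|$, the condition in \<open>num_pref\<close> leaves
  no room for blocks of size greater than \<open>r\<close>.
\<close>

definition block_types :: "nat \<Rightarrow> nat \<Rightarrow> (nat \<Rightarrow> nat) set" where
  "block_types r n = {\<alpha> \<in> {1..r} \<rightarrow>\<^sub>E UNIV. (\<Sum>i = 1..r. i * \<alpha> i) = n}"

text \<open>Neither the sum over \<open>block_types\<close> nor the cardinality in \<open>num_pref\<close> is degenerate.\<close>

lemma finite_block_types: "finite (block_types r n)"
proof (rule finite_subset)
  show "block_types r n \<subseteq> {1..r} \<rightarrow>\<^sub>E {..n}"
  proof
    fix \<alpha> assume a: "\<alpha> \<in> block_types r n"
    have "\<alpha> i \<le> n" if "i \<in> {1..r}" for i
    proof -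
      have "\<alpha> i \<le> i * \<alpha> i" using that by simp
      also have "\<dots> \<le> (\<Sum>i = 1..r. i * \<alpha> i)" using that by (intro member_le_sum) auto
      finally show ?thesis using a by (simp add: block_types_def)
    qed
    then show "\<alpha> \<in> {1..r} \<rightarrow>\<^sub>E {..n}"
      using a by (auto simp: block_types_def PiE_iff)
  qed
qed (simp add: finite_PiE)

lemma finite_preference_orderings:
  assumes "finite A"
  shows "finite (preference_orderings A)"
proof (rule finite_subset)
  show "preference_orderings A \<subseteq> Pow (Pow A) \<times> Pow (Pow A \<times> Pow A)"
    by (fastforce simp: preference_orderings_def partition_on_def order_on_defs)
qed (use assms in simp)

end

theory Submission
  imports Defs
begin

text \<open>
  Weight a preference ordering with blocks of size at most \<open>r\<close> by the product of the variables
  indexed by its block sizes, and let $W(A)$ be the total weight. Splitting off the first block $B$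
  gives $W(A) = \sum_B x_{|B|} W(A \setminus B)$. There are $\binom{n}{i}$ choices of $B$ with
  $|B| = i$, so $W(A)/n!$ satisfies the recursion of the $r$-Fibonacci polynomials at $x_i/i!$.
  Collecting the orderings with equal block sizes yields the right-hand side.
\<close>

section \<open>Substitution in polynomials\<close>

text \<open>The inner product of \<open>mpoly_subst\<close>, named so that its multiplicativity can
  be stated separately.\<close>

definition monom_subst :: "(nat \<Rightarrow> mpoly) \<Rightarrow> (nat \<Rightarrow>\<^sub>0 nat) \<Rightarrow> mpoly" where
  "monom_subst f m = (\<Prod>i \<in> Poly_Mapping.keys m. f i ^ Poly_Mapping.lookup m i)"

text \<open>Outside the support the exponent is 0 and the factor is 1. Monomials with different
  supports can thus be evaluated over a common index set.\<close>

lemma monom_subst_superset: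
  assumes "finite S" "Poly_Mapping.keys m \<subseteq> S"
  shows "monom_subst f m = (\<Prod>i \<in> S. f i ^ Poly_Mapping.lookup m i)"
  unfolding monom_subst_def using assms
  by (intro prod.mono_neutral_left) (auto simp: in_keys_iff)

lemma monom_subst_add: "monom_subst f (m + m') = monom_subst f m * monom_subst f m'"
proof -
  let ?S = "Poly_Mapping.keys m \<union> Poly_Mapping.keys m'"
  have "Poly_Mapping.keys (m + m') \<subseteq> ?S"
    by (rule Poly_Mapping.keys_add)
  then show ?thesis
    by (simp add: monom_subst_superset[of ?S] lookup_add power_add prod.distrib)
qed

lemma Const_add: "Const (a + b) = Const a + Const b"
  by (simp add: Const_def single_add)

lemma Const_mult: "Const (a * b) = Const a * Const b"
  by (simp add: Const_def mult_single)

lemma Const_0 [simp]: "Const 0 = 0"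
  by (simp add: Const_def)

lemma Const_1 [simp]: "Const 1 = 1"
  by (simp add: Const_def)

lemma Const_of_nat: "Const (of_nat n) = of_nat n"
  by (induction n) (simp_all add: Const_add)

lemma mpoly_subst_superset:
  assumes "finite S" "Poly_Mapping.keys p \<subseteq> S"
  shows "mpoly_subst f p = (\<Sum>m \<in> S. Const (Poly_Mapping.lookup p m) * monom_subst f m)"
  unfolding mpoly_subst_def monom_subst_def[symmetric] using assms
  by (intro sum.mono_neutral_left) (auto simp: in_keys_iff)

lemma mpoly_subst_add: "mpoly_subst f (p + q) = mpoly_subst f p + mpoly_subst f q"
proof -
  let ?S = "Poly_Mapping.keys p \<union> Poly_Mapping.keys q"
  have "Poly_Mapping.keys (p + q) \<subseteq> ?S"
    by (rule Poly_Mapping.keys_add)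
  then show ?thesis
    by (simp add: mpoly_subst_superset[of ?S] lookup_add Const_add distrib_right sum.distrib)
qed

lemma mpoly_subst_single: "mpoly_subst f (Poly_Mapping.single m c) = Const c * monom_subst f m"
  by (simp add: mpoly_subst_superset[of "{m}"])

lemma mpoly_subst_0 [simp]: "mpoly_subst f 0 = 0"
  by (simp add: mpoly_subst_def)

lemma mpoly_subst_1 [simp]: "mpoly_subst f 1 = 1"
  using mpoly_subst_single[of f 0 1] by (simp add: monom_subst_def)

lemma mpoly_subst_sum: "mpoly_subst f (sum g S) = (\<Sum>i\<in>S. mpoly_subst f (g i))"
  by (induction S rule: infinite_finite_induct) (simp_all add: mpoly_subst_add)

lemma poly_mapping_sum_single:
  "p = (\<Sum>m \<in> Poly_Mapping.keys p. Poly_Mapping.single m (Poly_Mapping.lookup p m))"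
  by (rule poly_mapping_eqI) (simp add: lookup_sum lookup_single when_def in_keys_iff)

text \<open>Writing polynomials as sums of single terms reduces this to monomials, where
  \<open>monom_subst_add\<close> applies. With additivity, it carries the recursion of
  \<open>rfib\<close> through the substitution.\<close>

lemma mpoly_subst_Var_mult: "mpoly_subst f (Var i * p) = f i * mpoly_subst f p"
proof -
  have *: "monom_subst f (Poly_Mapping.single i 1) = f i"
    by (simp add: monom_subst_def)
  show ?thesis
    by (subst (1 2) poly_mapping_sum_single)
      (simp add: sum_distrib_left mpoly_subst_sum Var_def mult_single mpoly_subst_single
        monom_subst_add *[simplified] mult.left_commute)
qed

section \<open>Splitting off the first block\<close>

text \<open>The pairs \<open>{B} \<times> insert B P\<close> place \<open>B\<close> below every
  block, including itself since the order is reflexive.\<close>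

definition cons_block :: "'a set \<Rightarrow> 'a set set \<times> 'a set rel \<Rightarrow> 'a set set \<times> 'a set rel" where
  "cons_block B = (\<lambda>(P, L). (insert B P, L \<union> {B} \<times> insert B P))"

lemma fst_cons_block [simp]: "fst (cons_block B q) = insert B (fst q)"
  by (simp add: cons_block_def split: prod.split)

lemma linear_order_on_least:
  assumes "linear_order_on P L" "finite P" "P \<noteq> {}"
  obtains B where "B \<in> P" "\<And>C. C \<in> P \<Longrightarrow> (B, C) \<in> L"
proof -
  \<comment> \<open>The order on \<open>P\<close> stays fixed while the induction runs over nonempty
    subsets \<open>Q\<close>; a new element is compared with the least element of the previous
    subset.\<close>
  have "\<exists>B\<in>Q. \<forall>C\<in>Q. (B, C) \<in> L" if "finite Q" "Q \<noteq> {}" "Q \<subseteq> P" for Q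
    using that
  proof (induction Q rule: finite_ne_induct)
    case (singleton B)
    then show ?case
      using assms(1) by (auto simp: order_on_defs refl_on_def)
  next
    case (insert D Q)
    then obtain B where B: "B \<in> Q" "\<forall>C\<in>Q. (B, C) \<in> L"
      by auto
    have refl: "refl_on P L" and tr: "trans L" and tot: "total_on P L"
      using assms(1) by (auto simp: order_on_defs)
    have DD: "(D, D) \<in> L"
      using insert.prems refl by (auto simp: refl_on_def)
    have "(D, B) \<in> L \<or> (B, D) \<in> L"
      using insert.prems B(1) tot DD unfolding total_on_def by (cases "D = B") auto
    then show ?case
      using B DD tr unfolding trans_def by blast
  qed
  from this[OF assms(2,3) subset_refl] show thesis
    by (auto intro: that)
qed

lemma linear_order_on_insert_least:
  assumes "linear_order_on P L" "B \<notin> P"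
  shows "linear_order_on (insert B P) (L \<union> {B} \<times> insert B P)"
proof -
  have "L \<subseteq> P \<times> P" "refl_on P L" "trans L" "antisym L" "total_on P L"
    using assms(1) by (auto simp: order_on_defs)
  then show ?thesis
    using assms(2) unfolding order_on_defs refl_on_def trans_def antisym_def total_on_def
    by (intro conjI; blast)
qed

lemma cons_block_in_preference_orderings:
  assumes "B \<subseteq> A" "B \<noteq> {}" "q \<in> preference_orderings (A - B)"
  shows "cons_block B q \<in> preference_orderings A" "B \<notin> fst q"
proof -
  obtain P L where q: "q = (P, L)" by force
  have P: "partition_on (A - B) P" and L: "linear_order_on P L"
    using assms(3) by (auto simp: q preference_orderings_def)
  have "B \<notin> P"
    using P assms(2) by (auto simp: partition_on_def)
  moreover have "partition_on A (insert B P)"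
    using P assms(1,2) by (subst partition_on_insert) (auto simp: partition_on_def disjnt_def)
  ultimately show "cons_block B q \<in> preference_orderings A" "B \<notin> fst q"
    using linear_order_on_insert_least[OF L]
    by (auto simp: q cons_block_def preference_orderings_def)
qed

lemma preference_orderings_fst_finite:
  assumes "finite A" "q \<in> preference_orderings A"
  shows "finite (fst q)"
  using assms by (auto simp: preference_orderings_def intro: finite_elements)

text \<open>The first block can be read off as the least element of the relation, and deleting it
  recovers the remaining ordering.\<close>

lemma cons_block_inj:
  assumes "B \<noteq> {}" "q \<in> preference_orderings (A - B)"
    and "B' \<noteq> {}" "q' \<in> preference_orderings (A - B')"
    and eq: "cons_block B q = cons_block B' q'"
  shows "B = B' \<and> q = q'"
proof -
  obtain P L P' L' where q: "q = (P, L)" "q' = (P', L')" by force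
  have L: "L \<subseteq> P \<times> P" "L' \<subseteq> P' \<times> P'"
    using assms by (auto simp: q preference_orderings_def order_on_defs)
  have B: "B \<notin> P" "B' \<notin> P'"
    using assms by (auto simp: q preference_orderings_def partition_on_def)
  have eqs: "insert B P = insert B' P'"
      "L \<union> {B} \<times> insert B P = L' \<union> {B'} \<times> insert B' P'"
    using eq unfolding q cons_block_def prod.case prod.inject by blast+
  have "B = B'"
  proof (rule ccontr)
    assume "B \<noteq> B'"
    \<comment> \<open>On the right-hand side \<open>B'\<close> precedes every block, hence also
      \<open>B\<close>; on the left-hand side only \<open>B\<close> itself precedes
      \<open>B\<close>.\<close>
    then have "(B', B) \<in> L \<union> {B} \<times> insert B P"
      using eqs by blast
    then show False
      using L B \<open>B \<noteq> B'\<close> by blast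
  qed
  moreover from this have "P = P'"
    using eqs(1) B by (simp add: insert_ident)
  moreover have "L = L'"
  proof -
    have "L = (L \<union> {B} \<times> insert B P) - {B} \<times> UNIV"
      using L(1) B(1) by auto
    also have "\<dots> = (L' \<union> {B'} \<times> insert B' P') - {B'} \<times> UNIV"
      unfolding eqs(2) unfolding \<open>B = B'\<close> ..
    also have "\<dots> = L'"
      using L(2) B(2) by auto
    finally show ?thesis .
  qed
  ultimately show ?thesis
    by (simp add: q)
qed

text \<open>Surjectivity of \<open>cons_block\<close>: take \<open>B\<close> to be the least block
  and restrict the order to the other blocks.\<close>

lemma preference_orderings_cases:
  assumes "finite A" "A \<noteq> {}" "p \<in> preference_orderings A"
  obtains B q where "B \<subseteq> A" "B \<noteq> {}" "q \<in> preference_orderings (A - B)" "p = cons_block B q"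
proof -
  obtain P L where p: "p = (P, L)" by force
  have P: "partition_on A P" and L: "linear_order_on P L"
    using assms(3) by (auto simp: p preference_orderings_def)
  have LP: "L \<subseteq> P \<times> P" "refl_on P L" "trans L" "antisym L" "total_on P L"
    using L by (auto simp: order_on_defs)
  have "P \<noteq> {}"
    using P assms(2) by (auto simp: partition_on_def)
  then obtain B where B: "B \<in> P" "\<And>C. C \<in> P \<Longrightarrow> (B, C) \<in> L"
    using linear_order_on_least[OF L] finite_elements[OF assms(1) P] by blast
  let ?q = "(P - {B}, L \<inter> (P - {B}) \<times> (P - {B}))"
  have "partition_on (A - B) (P - {B})"
    using P B(1) unfolding partition_on_def disjoint_def by blast
  moreover have "linear_order_on (P - {B}) (snd ?q)"
    using LP unfolding order_on_defs refl_on_def trans_def antisym_def total_on_def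
    by (intro conjI; simp; blast)
  ultimately have "?q \<in> preference_orderings (A - B)"
    by (simp add: preference_orderings_def)
  \<comment> \<open>The restriction loses only pairs involving \<open>B\<close>. By antisymmetry
    each of these has \<open>B\<close> as first component, so \<open>{B} \<times> P\<close> restores
    them.\<close>
  moreover have "snd ?q \<union> {B} \<times> P = L"
  proof (intro equalityI subrelI)
    fix C D assume CD: "(C, D) \<in> L"
    have "D = B" if "C \<noteq> B" "D \<notin> P - {B}"
      using that CD LP(1) by blast
    moreover have "C = B" if "D = B"
      using that CD B LP(1,4) unfolding antisym_def by blast
    ultimately show "(C, D) \<in> snd ?q \<union> {B} \<times> P"
      using CD LP(1) by auto
  qed (use B in auto)
  then have "p = cons_block B ?q"
    by (simp only: p cons_block_def prod.case snd_conv insert_Diff[OF B(1)])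
  moreover have "B \<subseteq> A" "B \<noteq> {}"
    using B(1) P by (auto simp: partition_on_def)
  ultimately show thesis
    by (intro that)
qed

section \<open>Weighted preference orderings\<close>

definition bounded_prefs :: "nat \<Rightarrow> 'a set \<Rightarrow> ('a set set \<times> 'a set rel) set" where
  "bounded_prefs r A = {p \<in> preference_orderings A. \<forall>B\<in>fst p. card B \<le> r}"

text \<open>The total weight $W(A)$, over an arbitrary commutative semiring; the theorem takes
  \<open>x\<close> to be \<open>Var\<close>.\<close>

definition pref_weight :: "nat \<Rightarrow> (nat \<Rightarrow> 'b) \<Rightarrow> 'a set \<Rightarrow> 'b::comm_semiring_1" where
  "pref_weight r x A = (\<Sum>p\<in>bounded_prefs r A. \<Prod>B\<in>fst p. x (card B))"

lemma finite_bounded_prefs: "finite A \<Longrightarrow> finite (bounded_prefs r A)"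
  by (simp add: bounded_prefs_def finite_preference_orderings)

lemma pref_weight_empty [simp]: "pref_weight r x ({} :: 'a set) = 1"
proof -
  have "bounded_prefs r ({} :: 'a set) = {({}, {})}"
    by (auto simp: bounded_prefs_def preference_orderings_def partition_on_def order_on_defs
        refl_on_def)
  then show ?thesis
    by (simp add: pref_weight_def)
qed

text \<open>\<open>cons_block\<close> is a bijection from pairs of a first block and an ordering of
  the rest onto the orderings of \<open>A\<close>, and it multiplies the weight by
  \<open>x (card B)\<close>.\<close>

lemma pref_weight_rec:
  assumes "finite A" "A \<noteq> {}"
  shows "pref_weight r x A =
    (\<Sum>B | B \<subseteq> A \<and> B \<noteq> {} \<and> card B \<le> r. x (card B) * pref_weight r x (A - B))"
proof -
  let ?S = "{B. B \<subseteq> A \<and> B \<noteq> {} \<and> card B \<le> r}"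
  let ?T = "Sigma ?S (\<lambda>B. bounded_prefs r (A - B))"
  have "(\<lambda>(B, q). cons_block B q) ` ?T = bounded_prefs r A"
  proof (intro equalityI subsetI)
    fix p assume "p \<in> (\<lambda>(B, q). cons_block B q) ` ?T"
    then show "p \<in> bounded_prefs r A"
      using cons_block_in_preference_orderings
      by (auto simp: bounded_prefs_def)
  next
    fix p assume p: "p \<in> bounded_prefs r A"
    then obtain B q where "B \<subseteq> A" "B \<noteq> {}" "q \<in> preference_orderings (A - B)" "p = cons_block B q"
      using preference_orderings_cases[OF assms, of p]
      by (metis (mono_tags, lifting) bounded_prefs_def mem_Collect_eq)
    with p have "(B, q) \<in> ?T"
      by (auto simp: bounded_prefs_def)
    with \<open>p = cons_block B q\<close> show "p \<in> (\<lambda>(B, q). cons_block B q) ` ?T"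
      by force
  qed
  moreover have "inj_on (\<lambda>(B, q). cons_block B q) ?T"
  proof (rule inj_onI)
    fix b b' assume *: "b \<in> ?T" "b' \<in> ?T"
      and eq: "(case b of (B, q) \<Rightarrow> cons_block B q) = (case b' of (B, q) \<Rightarrow> cons_block B q)"
    obtain B q B' q' where b: "b = (B, q)" "b' = (B', q')"
      by (metis surj_pair)
    have "B = B' \<and> q = q'"
      by (rule cons_block_inj[where A = A]) (use * eq in \<open>auto simp: b bounded_prefs_def\<close>)
    then show "b = b'"
      by (simp add: b)
  qed
  ultimately have "pref_weight r x A =
      (\<Sum>(B, q)\<in>?T. \<Prod>C\<in>fst (cons_block B q). x (card C))"
    unfolding pref_weight_def
    by (intro sum.reindex_cong[where l = "\<lambda>(B, q). cons_block B q"]) (auto simp del: fst_cons_block)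
  also have "\<dots> = (\<Sum>(B, q)\<in>?T. x (card B) * (\<Prod>C\<in>fst q. x (card C)))"
  proof (intro sum.cong refl, clarify)
    fix B P L assume B: "B \<subseteq> A" "B \<noteq> {}" and q: "(P, L) \<in> bounded_prefs r (A - B)"
    \<comment> \<open>Newness of \<open>B\<close> lets its factor split off from the product over
      the set \<open>insert B P\<close>.\<close>
    have "B \<notin> P"
      using cons_block_in_preference_orderings(2)[OF B] q by (force simp: bounded_prefs_def)
    moreover have "finite P"
      using preference_orderings_fst_finite[of "A - B" "(P, L)"] q assms(1)
      by (auto simp: bounded_prefs_def)
    ultimately show "(\<Prod>C\<in>fst (cons_block B (P, L)). x (card C)) =
        x (card B) * (\<Prod>C\<in>fst (P, L). x (card C))"
      by simp
  qed
  also have "\<dots> = (\<Sum>B\<in>?S. \<Sum>q\<in>bounded_prefs r (A - B). x (card B) * (\<Prod>C\<in>fst q. x (card C)))"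
    using assms(1) by (intro sum.Sigma[symmetric]) (auto intro: finite_bounded_prefs)
  finally show ?thesis
    by (simp add: pref_weight_def sum_distrib_left)
qed

text \<open>Induction on \<open>A\<close>, grouping the first blocks by size. The element
  \<open>c i\<close> stands for $1/i!$ and is given by its defining equation because a semiring has
  no division.\<close>

lemma pref_weight_eq_fact_mult:
  fixes x c g :: "nat \<Rightarrow> 'b::comm_semiring_1"
  assumes c: "\<And>i. of_nat (fact i) * c i = 1"
    and g_0: "g 0 = 1"
    and g_rec: "\<And>n. n > 0 \<Longrightarrow> g n = (\<Sum>i = 1..min r n. c i * x i * g (n - i))"
    and "finite A"
  shows "pref_weight r x A = of_nat (fact (card A)) * g (card A)"
  using \<open>finite A\<close>
proof (induction A rule: finite_psubset_induct)
  case (psubset A)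
  show ?case
  proof (cases "A = {}")
    case True
    then show ?thesis by (simp add: g_0)
  next
    case False
    let ?n = "card A"
    have n: "?n > 0"
      using False psubset.hyps by (simp add: card_gt_0_iff)
    let ?S = "{B. B \<subseteq> A \<and> B \<noteq> {} \<and> card B \<le> r}"
    have fin: "finite ?S"
      using psubset.hyps by simp
    have img: "card ` ?S \<subseteq> {1..min r ?n}"
      using psubset.hyps by (auto simp: card_mono Suc_le_eq card_gt_0_iff dest: finite_subset)
    have "pref_weight r x A =
        (\<Sum>B\<in>?S. x (card B) * (of_nat (fact (?n - card B)) * g (?n - card B)))"
    proof (subst pref_weight_rec[OF psubset.hyps False], intro sum.cong refl)
      fix B assume B: "B \<in> ?S"
      then have "card (A - B) = ?n - card B"
        using psubset.hyps by (auto intro!: card_Diff_subset intro: finite_subset)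
      moreover have "A - B \<subset> A"
        using B by auto
      ultimately show "x (card B) * pref_weight r x (A - B) =
          x (card B) * (of_nat (fact (?n - card B)) * g (?n - card B))"
        using psubset.IH by metis
    qed
    also have "\<dots> = (\<Sum>i = 1..min r ?n. \<Sum>B | B \<in> ?S \<and> card B = i.
        x (card B) * (of_nat (fact (?n - card B)) * g (?n - card B)))"
      by (rule sum.group[symmetric, OF fin _ img]) simp
    also have "\<dots> = (\<Sum>i = 1..min r ?n. of_nat (fact ?n) * (c i * x i * g (?n - i)))"
    proof (intro sum.cong refl)
      fix i assume i: "i \<in> {1..min r ?n}"
      have "{B. B \<in> ?S \<and> card B = i} = {B. B \<subseteq> A \<and> card B = i}"
        using i by auto
      then have "(\<Sum>B | B \<in> ?S \<and> card B = i.
            x (card B) * (of_nat (fact (?n - card B)) * g (?n - card B)))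
          = (\<Sum>B | B \<subseteq> A \<and> card B = i. x i * (of_nat (fact (?n - i)) * g (?n - i)))"
        by (intro sum.cong) auto
      also have "\<dots> = of_nat (?n choose i) * (x i * (of_nat (fact (?n - i)) * g (?n - i)))"
        using psubset.hyps by (simp add: n_subsets)
      also have "\<dots> = (of_nat (fact i) * c i) *
          (of_nat (?n choose i) * (x i * (of_nat (fact (?n - i)) * g (?n - i))))"
        by (simp only: c mult_1_left)
      also have "\<dots> = of_nat (fact i * fact (?n - i) * (?n choose i)) * (c i * x i * g (?n - i))"
        by (simp only: of_nat_mult ac_simps)
      also have "fact i * fact (?n - i) * (?n choose i) = fact ?n"
        using i by (intro binomial_fact_lemma) auto
      finally show "(\<Sum>B | B \<in> ?S \<and> card B = i.
            x (card B) * (of_nat (fact (?n - card B)) * g (?n - card B)))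
          = of_nat (fact ?n) * (c i * x i * g (?n - i))" .
    qed
    also have "\<dots> = of_nat (fact ?n) * g ?n"
      by (simp add: g_rec[OF n] sum_distrib_left)
    finally show ?thesis .
  qed
qed

section \<open>Grouping by block sizes\<close>

text \<open>Restricting to \<open>{1..r}\<close> makes the tuple extensional, as membership in
  \<open>block_types\<close> demands.\<close>

definition block_type :: "nat \<Rightarrow> 'a set set \<Rightarrow> nat \<Rightarrow> nat" where
  "block_type r P = (\<lambda>i\<in>{1..r}. card {B \<in> P. card B = i})"

lemma partition_card_block:
  assumes "finite A" "partition_on A P" "B \<in> P"
  shows "card B \<ge> 1"
proof -
  have "B \<subseteq> A" "B \<noteq> {}"
    using assms(2,3) by (auto simp: partition_on_def)
  then show ?thesis
    using assms(1) by (simp add: Suc_le_eq card_gt_0_iff finite_subset)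
qed

text \<open>Group the blocks by size. Blocks are nonempty, so the sizes from 1 to \<open>r\<close>
  account for every block of size at most \<open>r\<close>.\<close>

lemma sum_small_blocks:
  assumes "finite A" "partition_on A P"
  shows "(\<Sum>i = 1..r. i * card {B \<in> P. card B = i}) = (\<Sum>B | B \<in> P \<and> card B \<le> r. card B)"
proof -
  let ?Q = "{B \<in> P. card B \<le> r}"
  have "(\<Sum>i = 1..r. i * card {B \<in> P. card B = i}) = (\<Sum>i = 1..r. \<Sum>B | B \<in> ?Q \<and> card B = i. card B)"
  proof (intro sum.cong refl)
    fix i assume i: "i \<in> {1..r}"
    have "{B. B \<in> ?Q \<and> card B = i} = {B \<in> P. card B = i}"
      using i by auto
    then show "i * card {B \<in> P. card B = i} = (\<Sum>B | B \<in> ?Q \<and> card B = i. card B)"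
      by simp
  qed
  also have "\<dots> = sum card ?Q"
    using finite_elements[OF assms] partition_card_block[OF assms]
    by (intro sum.group) auto
  finally show ?thesis .
qed

text \<open>The weighted sum of the type counts the elements lying in blocks of size at most
  \<open>r\<close>. It equals \<open>card A\<close> exactly when the larger blocks cover nothing,
  that is, when there are none.\<close>

lemma bounded_prefs_iff_block_types:
  assumes "finite A" "p \<in> preference_orderings A"
  shows "p \<in> bounded_prefs r A \<longleftrightarrow> block_type r (fst p) \<in> block_types r (card A)"
proof -
  define P where "P = fst p"
  define Q where "Q = {B \<in> P. card B \<le> r}"
  have P: "partition_on A P"
    using assms(2) by (auto simp: P_def preference_orderings_def)
  have fin: "finite P"
    using finite_elements[OF assms(1) P] .
  have card_A: "card A = sum card P"
    using P assms(1) by (intro product_partition) (auto simp: partition_on_def intro: finite_subset)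
  have "(\<Sum>i = 1..r. i * block_type r P i) = sum card Q"
    unfolding Q_def sum_small_blocks[OF assms(1) P, symmetric]
    by (intro sum.cong refl) (simp add: block_type_def)
  then have "block_type r P \<in> block_types r (card A) \<longleftrightarrow> sum card Q = card A"
    by (simp add: block_types_def block_type_def)
  moreover have "card A = sum card (P - Q) + sum card Q"
    unfolding card_A by (rule sum.subset_diff) (use fin in \<open>auto simp: Q_def\<close>)
  ultimately have "block_type r P \<in> block_types r (card A) \<longleftrightarrow> sum card (P - Q) = 0"
    by linarith
  also have "\<dots> \<longleftrightarrow> (\<forall>B\<in>P - Q. card B = 0)"
    by (rule sum_eq_0_iff) (use fin in simp)
  \<comment> \<open>A set of cardinality 0 would already belong to \<open>Q\<close>, so both
    conditions say that \<open>P - Q\<close> is empty.\<close>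
  also have "\<dots> \<longleftrightarrow> (\<forall>B\<in>P. card B \<le> r)"
  proof (intro iffI ballI)
    fix B assume "\<forall>B\<in>P - Q. card B = 0" "B \<in> P"
    then have "B \<in> Q \<or> card B = 0"
      by (metis DiffI)
    then show "card B \<le> r"
      unfolding Q_def by (elim disjE) simp_all
  next
    fix B assume "\<forall>B\<in>P. card B \<le> r" "B \<in> P - Q"
    then show "card B = 0"
      unfolding Q_def by blast
  qed
  finally show ?thesis
    using assms(2) by (simp add: bounded_prefs_def P_def)
qed

lemma prod_block_weights:
  fixes x :: "nat \<Rightarrow> 'b::comm_semiring_1"
  assumes "finite A" "p \<in> bounded_prefs r A"
  shows "(\<Prod>B\<in>fst p. x (card B)) = (\<Prod>i = 1..r. x i ^ block_type r (fst p) i)"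
proof -
  have P: "partition_on A (fst p)"
    using assms(2) by (auto simp: bounded_prefs_def preference_orderings_def)
  have "(\<Prod>B\<in>fst p. x (card B)) = (\<Prod>i = 1..r. \<Prod>B | B \<in> fst p \<and> card B = i. x (card B))"
    using finite_elements[OF assms(1) P] partition_card_block[OF assms(1) P] assms(2)
    by (intro prod.group[symmetric]) (auto simp: bounded_prefs_def)
  also have "\<dots> = (\<Prod>i = 1..r. x i ^ block_type r (fst p) i)"
    by (intro prod.cong refl) (simp add: block_type_def)
  finally show ?thesis .
qed

text \<open>Group the orderings by block type: all orderings of type \<open>\<alpha>\<close> have
  the same monomial as weight, and \<open>num_pref\<close> counts them.\<close>

lemma pref_weight_eq_sum_block_types:
  fixes A :: "'a set"
  assumes "finite A"
  shows "pref_weight r x A =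
    (\<Sum>\<alpha>\<in>block_types r (card A). of_nat (num_pref A r \<alpha>) * (\<Prod>i = 1..r. x i ^ \<alpha> i))"
proof -
  have "pref_weight r x A = (\<Sum>\<alpha>\<in>block_types r (card A).
      \<Sum>p | p \<in> bounded_prefs r A \<and> block_type r (fst p) = \<alpha>. \<Prod>B\<in>fst p. x (card B))"
    unfolding pref_weight_def
    using assms finite_bounded_prefs[OF assms] bounded_prefs_iff_block_types[OF assms]
    by (intro sum.group[symmetric] finite_block_types) (auto simp: bounded_prefs_def)
  also have "\<dots> = (\<Sum>\<alpha>\<in>block_types r (card A).
      of_nat (num_pref A r \<alpha>) * (\<Prod>i = 1..r. x i ^ \<alpha> i))"
  proof (intro sum.cong refl)
    fix \<alpha> assume \<alpha>: "\<alpha> \<in> block_types r (card A)"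
    let ?T = "{p. p \<in> bounded_prefs r A \<and> block_type r (fst p) = \<alpha>}"
    have ext: "\<alpha> \<in> extensional {1..r}"
      using \<alpha> by (auto simp: block_types_def PiE_def)
    have type_iff: "block_type r P = \<alpha> \<longleftrightarrow> (\<forall>i\<in>{1..r}. card {B \<in> P. card B = i} = \<alpha> i)"
      for P :: "'a set set"
      using ext by (auto simp: block_type_def fun_eq_iff extensional_def restrict_def)
    \<comment> \<open>The type \<open>\<alpha>\<close> already uses up all elements of
      \<open>A\<close>, so the bound on block sizes is automatic.\<close>
    have "?T = {p \<in> preference_orderings A. block_type r (fst p) = \<alpha>}"
      using bounded_prefs_iff_block_types[OF assms] \<alpha> by (auto simp: bounded_prefs_def)
    also have "\<dots> = {(P, L) \<in> preference_orderings A.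
        \<forall>i\<in>{1..r}. card {B \<in> P. card B = i} = \<alpha> i}"
      by (auto simp: type_iff)
    finally have "card ?T = num_pref A r \<alpha>"
      by (simp add: num_pref_def)
    moreover have "(\<Sum>p\<in>?T. \<Prod>B\<in>fst p. x (card B)) = (\<Sum>p\<in>?T. \<Prod>i = 1..r. x i ^ \<alpha> i)"
      using prod_block_weights[OF assms] by (intro sum.cong) auto
    ultimately show "(\<Sum>p\<in>?T. \<Prod>B\<in>fst p. x (card B)) =
        of_nat (num_pref A r \<alpha>) * (\<Prod>i = 1..r. x i ^ \<alpha> i)"
      by simp
  qed
  finally show ?thesis .
qed

section \<open>The shifted r-Fibonacci recursion and the conclusion\<close>

lemma rfib_shift_rec:
  assumes "r \<ge> 1" "n > 0"
  shows "rfib r (n + r - 1) = (\<Sum>i = 1..min r n. Var i * rfib r ((n - i) + r - 1))"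
proof -
  have "rfib r (n + r - 1) = (\<Sum>i = 1..r. Var i * rfib r (n + r - 1 - i))"
    using assms by (subst rfib.simps) auto
  also have "\<dots> = (\<Sum>i = 1..min r n. Var i * rfib r (n + r - 1 - i))"
  proof (intro sum.mono_neutral_right ballI)
    \<comment> \<open>Here \<open>n < i \<le> r\<close>, so the index lies below
      \<open>r - 1\<close>, among the zero initial values.\<close>
    fix i assume "i \<in> {1..r} - {1..min r n}"
    then have "rfib r (n + r - 1 - i) = 0"
      using assms by (subst rfib.simps) auto
    then show "Var i * rfib r (n + r - 1 - i) = 0"
      by simp
  qed auto
  also have "\<dots> = (\<Sum>i = 1..min r n. Var i * rfib r ((n - i) + r - 1))"
    by (intro sum.cong refl arg_cong2[where f = "(*)"] arg_cong[where f = "rfib r"]) auto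
  finally show ?thesis .
qed

theorem theorem4p7:
  fixes r n :: nat and A :: "'a set"
  assumes "r \<ge> 1" and "n \<ge> 1" and "finite A" and "card A = n"
  shows "of_nat (fact n) * mpoly_subst (\<lambda>i. Const (1 / fact i) * Var i) (rfib r (n + r - 1)) =
    (\<Sum>\<alpha> \<in> block_types r n. of_nat (num_pref A r \<alpha>) * (\<Prod>i = 1..r. Var i ^ \<alpha> i))"
proof -
  let ?f = "\<lambda>i. Const (1 / fact i) * Var i"
  let ?g = "\<lambda>m. mpoly_subst ?f (rfib r (m + r - 1))"
  have "pref_weight r Var A = of_nat (fact (card A)) * ?g (card A)"
  proof (rule pref_weight_eq_fact_mult[where c = "\<lambda>i. Const (1 / fact i)"])
    fix i
    show "of_nat (fact i) * Const (1 / fact i) = 1"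
      by (simp flip: Const_of_nat Const_mult)
  next
    \<comment> \<open>As \<open>r \<ge> 1\<close>, the index \<open>0 + r - 1\<close> is exactly the
      position of the initial value 1.\<close>
    show "?g 0 = 1"
      using assms(1) by (subst rfib.simps) simp
  next
    fix m :: nat assume "m > 0"
    then show "?g m = (\<Sum>i = 1..min r m. Const (1 / fact i) * Var i * ?g (m - i))"
      by (subst rfib_shift_rec[OF assms(1)]) (simp_all only: mpoly_subst_sum mpoly_subst_Var_mult)
  qed (rule assms(3))
  then show ?thesis
    using pref_weight_eq_sum_block_types[OF assms(3), of r Var] assms(4) by simp
qed

end
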